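(* Let $m\ge n>k\ge 1$ be integers and let $A\in\mathbb{R}^{m\times n}$ have singular values $\sigma_1\ge\sigma_2\ge\dots\ge\sigma_n\ge 0$ with $\sigma_k>0$. Let $A=U\Sigma V^T$ be a thin SVD of $A$ and let $\Sigma_\perp=\mathrm{diag}(\sigma_{k+1},\dots,\sigma_n)$. Let $\Omega\in\mathbb{R}^{m\times n}$ be a standard Gaussian random matrix, let $\Omega_1\in\mathbb{R}^{m\times k}$ be its first $k$ columns, and write $U^T\Omega_1=\begin{bmatrix}\widetilde\Omega_1\\ \widetilde\Omega_2\end{bmatrix}$ with $\widetilde\Omega_1\in\mathbb{R}^{k\times k}$ and $\widetilde\Omega_2\in\mathbb{R}^{(n-k)\times k}$. Let $A=QLP^T$ be the factorization produced by Rand-QLP (defined in the context) from $A$ and $\Omega$, and let $Q_k\in\mathbb{R}^{m\times k}$ and $P_k\in\mathbb{R}^{n\times k}$ be formed by the first $k$ columns of $Q$ and $P$, respectively. Let $\psi_k=\sigma_{k+1}/\sigma_k$. Then, on the event that $\widetilde\Omega_1$ is invertible (which has probability one), for each $\rho\in\{2,F\}$, $$\|(I-Q_kQ_k^T)A\|_\rho\ \le\ \|\Sigma_\perp\|_\rho+\|A\|_\rho\,\psi_k^2\,\|\widetilde\Omega_2\widetilde\Omega_1^{-1}\|_2,$$ $$\|A(I-P_kP_k^T)\|_\rho\ \le\ \|\Sigma_\perp\|_\rho+\|A\|_\rho\,\psi_k^3\,\|\widetilde\Omega_2\widetilde\Omega_1^{-1}\|_2.$$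
   Context: Thin SVD: $A=U\Sigma V^T$ with $U\in\mathbb{R}^{m\times n}$ having orthonormal columns, $\Sigma=\mathrm{diag}(\sigma_1,\dots,\sigma_n)$, $\sigma_1\ge\dots\ge\sigma_n\ge0$, and $V\in\mathbb{R}^{n\times n}$ orthogonal. Rand-QLP: given $A\in\mathbb{R}^{m\times n}$ ($m\ge n$) and $\Omega\in\mathbb{R}^{m\times n}$ (with i.i.d. standard normal entries), perform three unpivoted (reduced) QR factorizations: (1) $A^T\Omega=\bar Q\bar R$, with $\bar Q\in\mathbb{R}^{n\times n}$ orthogonal and $\bar R\in\mathbb{R}^{n\times n}$ upper triangular; (2) $A\bar Q=Q\hat R$, with $Q\in\mathbb{R}^{m\times n}$ having orthonormal columns and $\hat R\in\mathbb{R}^{n\times n}$ upper triangular; (3) $(Q^TA)^T=A^TQ=PR$, with $P\in\mathbb{R}^{n\times n}$ orthogonal and $R\in\mathbb{R}^{n\times n}$ upper triangular. Set $L=R^T$. Then $A=QLP^T$ with $L$ lower triangular. Any QR factorizations of the stated form may be used. $\|\cdot\|_2$ denotes the spectral norm and $\|\cdot\|_F$ the Frobenius norm. *)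

theory Defs
  imports "HOL-Probability.Probability" "Jordan_Normal_Form.Gauss_Jordan_Elimination"
begin

definition vec_norm2 :: "real vec \<Rightarrow> real" where
  "vec_norm2 v = sqrt (v \<bullet> v)"

definition spectral_norm :: "real mat \<Rightarrow> real" where
  "spectral_norm X =
     (SUP v \<in> {v \<in> carrier_vec (dim_col X). vec_norm2 v \<le> 1}. vec_norm2 (X *\<^sub>v v))"

definition frobenius_norm :: "real mat \<Rightarrow> real" where
  "frobenius_norm X = sqrt (\<Sum>i<dim_row X. \<Sum>j<dim_col X. (X $$ (i, j))\<^sup>2)"

(* Not the library's orthogonal_mat, which does not normalise the columns.
   For a square matrix this says that X is orthogonal. *)
definition orthonormal_cols :: "real mat \<Rightarrow> bool" where
  "orthonormal_cols X \<longleftrightarrow> transpose_mat X * X = 1\<^sub>m (dim_col X)"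

definition first_cols :: "nat \<Rightarrow> 'a mat \<Rightarrow> 'a mat" where
  "first_cols k X = Matrix.mat (dim_row X) k (\<lambda>(i, j). X $$ (i, j))"

definition first_rows :: "nat \<Rightarrow> 'a mat \<Rightarrow> 'a mat" where
  "first_rows k X = Matrix.mat k (dim_col X) (\<lambda>(i, j). X $$ (i, j))"

definition drop_rows :: "nat \<Rightarrow> 'a mat \<Rightarrow> 'a mat" where
  "drop_rows k X = Matrix.mat (dim_row X - k) (dim_col X) (\<lambda>(i, j). X $$ (i + k, j))"

(* The singular values are numbered from 1: only sigma 1, ..., sigma n are used. *)
definition thin_svd ::
  "nat \<Rightarrow> nat \<Rightarrow> real mat \<Rightarrow> real mat \<Rightarrow> (nat \<Rightarrow> real) \<Rightarrow> real mat \<Rightarrow> bool" where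
  "thin_svd m n A U \<sigma> V \<longleftrightarrow>
     U \<in> carrier_mat m n \<and> orthonormal_cols U \<and>
     V \<in> carrier_mat n n \<and> orthonormal_cols V \<and>
     (\<forall>i j. 1 \<le> i \<and> i \<le> j \<and> j \<le> n \<longrightarrow> \<sigma> j \<le> \<sigma> i) \<and>
     (\<forall>i. 1 \<le> i \<and> i \<le> n \<longrightarrow> 0 \<le> \<sigma> i) \<and>
     A = U * mat_diag n (\<lambda>i. \<sigma> (i + 1)) * transpose_mat V"

(* Reduced QR factorization of B. No sign or rank condition is imposed on the
   upper triangular factor, so the factorization need not be unique. *)
definition qr_factorization :: "real mat \<Rightarrow> real mat \<Rightarrow> real mat \<Rightarrow> bool" where
  "qr_factorization B Q R \<longleftrightarrow>
     Q \<in> carrier_mat (dim_row B) (dim_col B) \<and> orthonormal_cols Q \<and>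
     R \<in> carrier_mat (dim_col B) (dim_col B) \<and> upper_triangular R \<and>
     B = Q * R"

definition rand_qlp :: "real mat \<Rightarrow> real mat \<Rightarrow> real mat \<Rightarrow> real mat \<Rightarrow> real mat \<Rightarrow> bool" where
  "rand_qlp A Om Q L P \<longleftrightarrow>
     (\<exists>Qbar Rbar Rhat R.
        qr_factorization (transpose_mat A * Om) Qbar Rbar \<and>
        qr_factorization (A * Qbar) Q Rhat \<and>
        qr_factorization (transpose_mat (transpose_mat Q * A)) P R \<and>
        L = transpose_mat R)"

definition std_gaussian_matrix :: "'w measure \<Rightarrow> nat \<Rightarrow> nat \<Rightarrow> ('w \<Rightarrow> real mat) \<Rightarrow> bool" where
  "std_gaussian_matrix M m n \<Omega> \<longleftrightarrow>
     prob_space M \<and>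
     (\<forall>\<omega> \<in> space M. \<Omega> \<omega> \<in> carrier_mat m n) \<and>
     (\<forall>i < m. \<forall>j < n. distributed M lborel (\<lambda>\<omega>. \<Omega> \<omega> $$ (i, j)) std_normal_density) \<and>
     prob_space.indep_vars M (\<lambda>_. borel) (\<lambda>(i, j) \<omega>. \<Omega> \<omega> $$ (i, j)) ({..<m} \<times> {..<n})"

definition sketch_top :: "nat \<Rightarrow> real mat \<Rightarrow> real mat \<Rightarrow> real mat" where
  "sketch_top k U Om = first_rows k (transpose_mat U * first_cols k Om)"

definition sketch_bot :: "nat \<Rightarrow> real mat \<Rightarrow> real mat \<Rightarrow> real mat" where
  "sketch_bot k U Om = drop_rows k (transpose_mat U * first_cols k Om)"

(* mat_inverse is the partial inverse of the library: Some of the inverse for an invertible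
   square matrix, None otherwise. It is only used under an invertibility hypothesis. *)
abbreviation mat_inv :: "real mat \<Rightarrow> real mat" where
  "mat_inv X \<equiv> the (mat_inverse X)"

end

theory Submission
  imports Defs "Jordan_Normal_Form.Determinant"
begin

text \<open>Write \<open>A = U1 S1 V1\<^sup>T + U2 S2 V2\<^sup>T\<close>, and let \<open>T\<close> and \<open>B\<close> be the top and bottom blocks of
  \<open>U\<^sup>T \<Omega>1\<close>. The triangular factors give
  \<open>A A\<^sup>T \<Omega>1 = U1 S1\<^sup>2 T + U2 S2\<^sup>2 B = Qk W\<close> and
  \<open>A\<^sup>T A A\<^sup>T \<Omega>1 = V1 S1\<^sup>3 T + V2 S2\<^sup>3 B = Pk W'\<close> for some \<open>W\<close> and \<open>W'\<close>.
  Hence \<open>H = I - Qk Qk\<^sup>T\<close> annihilates \<open>U1 + U2 F\<close> with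
  \<open>F = S2\<^sup>2 B T\<^sup>-\<^sup>1 S1\<^sup>-\<^sup>2\<close>, whose spectral norm is at most \<open>\<psi>\<^sup>2 \<parallel>B T\<^sup>-\<^sup>1\<parallel>\<close>, and so
  \<open>H A = H U2 (S2 V2\<^sup>T - F U1\<^sup>T A)\<close>, which gives the first bound. The second is the same
  argument for \<open>A\<^sup>T\<close> with third powers. Almost sure invertibility of \<open>T\<close> holds because \<open>det T\<close> is
  a polynomial in the entries of \<open>\<Omega>1\<close> that equals 1 at \<open>\<Omega>1 = U1\<close>.\<close>

section \<open>Matrix norms\<close>

named_theorems mat_dim

text \<open>The rules in \<open>mat_dim\<close> ask for equations between dimensions instead of
  \<open>carrier_mat\<close> premises, so the simplifier can discharge them without guessing free
  dimensions. Products are normalised by nesting to the right.\<close>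

lemma mult_assoc_dim [mat_dim]:
  fixes A B C :: "'a :: semiring_0 mat"
  shows "dim_col A = dim_row B \<Longrightarrow> dim_col B = dim_row C \<Longrightarrow> (A * B) * C = A * (B * C)"
  by (rule assoc_mult_mat[of A "dim_row A" "dim_col A" B "dim_col B" C "dim_col C"]) auto

lemma mult_add_dim [mat_dim]:
  fixes A B C :: "'a :: semiring_0 mat"
  shows "dim_col A = dim_row B \<Longrightarrow> dim_row C = dim_row B \<Longrightarrow> dim_col C = dim_col B \<Longrightarrow>
    A * (B + C) = A * B + A * C"
  by (rule mult_add_distrib_mat[of A "dim_row A" "dim_col A" B "dim_col B"]) auto

lemma add_mult_dim [mat_dim]:
  fixes A B C :: "'a :: semiring_0 mat"
  shows "dim_row A = dim_row B \<Longrightarrow> dim_col A = dim_col B \<Longrightarrow> dim_row C = dim_col B \<Longrightarrow>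
    (A + B) * C = A * C + B * C"
  by (rule add_mult_distrib_mat[of A "dim_row A" "dim_col A" B]) auto

lemma mult_minus_dim [mat_dim]:
  fixes A B C :: "'a :: ring mat"
  shows "dim_col A = dim_row B \<Longrightarrow> dim_row C = dim_row B \<Longrightarrow> dim_col C = dim_col B \<Longrightarrow>
    A * (B - C) = A * B - A * C"
  by (rule mult_minus_distrib_mat[of A "dim_row A" "dim_col A" B "dim_col B"]) auto

lemma minus_mult_dim [mat_dim]:
  fixes A B C :: "'a :: ring mat"
  shows "dim_row A = dim_row B \<Longrightarrow> dim_col A = dim_col B \<Longrightarrow> dim_row C = dim_col B \<Longrightarrow>
    (A - B) * C = A * C - B * C"
  by (rule minus_mult_distrib_mat[of A "dim_row A" "dim_col A" B]) auto

lemma transpose_mult_dim [mat_dim]: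
  fixes A B :: "'a :: comm_semiring_0 mat"
  shows "dim_col A = dim_row B \<Longrightarrow> transpose_mat (A * B) = transpose_mat B * transpose_mat A"
  by (rule transpose_mult[of A "dim_row A" "dim_col A" B "dim_col B"]) auto

lemma transpose_add_dim [mat_dim]:
  fixes A B :: "'a :: semiring_0 mat"
  shows "dim_row A = dim_row B \<Longrightarrow> dim_col A = dim_col B \<Longrightarrow>
    transpose_mat (A + B) = transpose_mat A + transpose_mat B"
  by (rule transpose_add[of A "dim_row A" "dim_col A" B]) auto

lemma transpose_minus_dim [mat_dim]:
  fixes A B :: "'a :: ring mat"
  shows "dim_row A = dim_row B \<Longrightarrow> dim_col A = dim_col B \<Longrightarrow>
    transpose_mat (A - B) = transpose_mat A - transpose_mat B"
  by (rule transpose_minus[of A "dim_row A" "dim_col A" B]) auto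

lemma add_zero_dim [mat_dim]:
  fixes A :: "'a :: monoid_add mat"
  shows "dim_row A = r \<Longrightarrow> dim_col A = c \<Longrightarrow> 0\<^sub>m r c + A = A"
    and "dim_row A = r \<Longrightarrow> dim_col A = c \<Longrightarrow> A + 0\<^sub>m r c = A"
  by (rule left_add_zero_mat right_add_zero_mat; auto)+

lemmas [mat_dim] = left_mult_one_mat' right_mult_one_mat' left_mult_zero_mat' right_mult_zero_mat'

lemma mat_diag_dims [simp]:
  "dim_row (mat_diag n f) = n" "dim_col (mat_diag n f) = n"
  by (simp_all add: mat_diag_def)

lemma transpose_mat_diag [simp]: "transpose_mat (mat_diag n f) = mat_diag n f"
  by (auto simp: mat_diag_def)

section \<open>The Euclidean norm of vectors, through \<open>L2_set\<close>\<close>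

lemma vec_norm2_eq_L2_set: "vec_norm2 v = L2_set (\<lambda>i. v $ i) {..<dim_vec v}"
  by (simp add: vec_norm2_def L2_set_def scalar_prod_def power2_eq_square lessThan_atLeast0)

lemma vec_norm2_nonneg [simp]: "0 \<le> vec_norm2 v"
  by (simp add: vec_norm2_eq_L2_set)

lemma vec_norm2_zero [simp]: "vec_norm2 (0\<^sub>v n) = 0"
  by (simp add: vec_norm2_eq_L2_set L2_set_def)

lemma vec_norm2_square: "(vec_norm2 v)\<^sup>2 = v \<bullet> v"
  by (simp add: vec_norm2_def scalar_prod_def sum_nonneg)

lemma vec_norm2_smult: "vec_norm2 (a \<cdot>\<^sub>v v) = \<bar>a\<bar> * vec_norm2 v"
  by (simp add: vec_norm2_eq_L2_set L2_set_def power_mult_distrib real_sqrt_mult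
      flip: sum_distrib_left)

lemma vec_norm2_uminus: "vec_norm2 (- v) = vec_norm2 v"
  by (simp add: vec_norm2_eq_L2_set L2_set_def)

lemma vec_norm2_add_le:
  assumes "u \<in> carrier_vec n" "v \<in> carrier_vec n"
  shows "vec_norm2 (u + v) \<le> vec_norm2 u + vec_norm2 v"
proof -
  have "vec_norm2 (u + v) = L2_set (\<lambda>i. u $ i + v $ i) {..<n}"
    using assms unfolding vec_norm2_eq_L2_set by (intro L2_set_cong) auto
  then show ?thesis
    using assms L2_set_triangle_ineq[of "\<lambda>i. u $ i" "\<lambda>i. v $ i" "{..<n}"]
    by (simp add: vec_norm2_eq_L2_set)
qed

lemma abs_scalar_prod_le:
  assumes "u \<in> carrier_vec n" "v \<in> carrier_vec n"
  shows "\<bar>u \<bullet> v\<bar> \<le> vec_norm2 u * vec_norm2 v"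
proof -
  have "\<bar>u \<bullet> v\<bar> \<le> (\<Sum>i<n. \<bar>u $ i\<bar> * \<bar>v $ i\<bar>)"
    using assms sum_abs[of "\<lambda>i. u $ i * v $ i" "{..<n}"]
    by (simp add: scalar_prod_def abs_mult lessThan_atLeast0)
  then show ?thesis
    using assms L2_set_mult_ineq[of "\<lambda>i. u $ i" "\<lambda>i. v $ i" "{..<n}"]
    by (simp add: vec_norm2_eq_L2_set)
qed

section \<open>Frobenius and spectral norms\<close>

lemma frobenius_norm_rows:
  "frobenius_norm X = L2_set (\<lambda>i. vec_norm2 (row X i)) {..<dim_row X}"
  by (simp add: frobenius_norm_def L2_set_def vec_norm2_eq_L2_set sum_nonneg)

lemma frobenius_norm_nonneg [simp]: "0 \<le> frobenius_norm X"
  by (simp add: frobenius_norm_rows)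

lemma frobenius_norm_transpose [simp]: "frobenius_norm (transpose_mat X) = frobenius_norm X"
  by (simp add: frobenius_norm_def) (rule sum.swap)

lemma frobenius_norm_cols:
  "frobenius_norm X = L2_set (\<lambda>j. vec_norm2 (col X j)) {..<dim_col X}"
  using frobenius_norm_rows[of "transpose_mat X"] by (simp cong: L2_set_cong_simp)

text \<open>Cauchy-Schwarz in each row. This crude bound shows that the supremum in
  \<open>spectral_norm\<close> is over a bounded set.\<close>

lemma vec_norm2_mult_le_frobenius:
  assumes "X \<in> carrier_mat r c" "v \<in> carrier_vec c"
  shows "vec_norm2 (X *\<^sub>v v) \<le> frobenius_norm X * vec_norm2 v"
proof -
  have "vec_norm2 (X *\<^sub>v v) = L2_set (\<lambda>i. \<bar>row X i \<bullet> v\<bar>) {..<r}"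
    using assms by (simp add: vec_norm2_eq_L2_set L2_set_def)
  also have "\<dots> \<le> L2_set (\<lambda>i. vec_norm2 (row X i) * vec_norm2 v) {..<r}"
    using assms by (intro L2_set_mono abs_scalar_prod_le[of _ c]) auto
  also have "\<dots> = frobenius_norm X * vec_norm2 v"
    using assms by (simp add: frobenius_norm_rows L2_set_left_distrib)
  finally show ?thesis .
qed

lemma vec_norm2_mult_le_spectral_unit:
  assumes "X \<in> carrier_mat r c" "v \<in> carrier_vec c" "vec_norm2 v \<le> 1"
  shows "vec_norm2 (X *\<^sub>v v) \<le> spectral_norm X"
  unfolding spectral_norm_def
proof (rule cSUP_upper)
  show "v \<in> {v \<in> carrier_vec (dim_col X). vec_norm2 v \<le> 1}" using assms by simp
  show "bdd_above ((\<lambda>v. vec_norm2 (X *\<^sub>v v)) ` {v \<in> carrier_vec (dim_col X). vec_norm2 v \<le> 1})"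
    using assms(1) by (intro bdd_aboveI2[where M = "frobenius_norm X"])
      (fastforce intro: order_trans[OF vec_norm2_mult_le_frobenius] mult_left_le)
qed

lemma spectral_norm_le:
  assumes "X \<in> carrier_mat r c"
    and "\<And>v. v \<in> carrier_vec c \<Longrightarrow> vec_norm2 v \<le> 1 \<Longrightarrow> vec_norm2 (X *\<^sub>v v) \<le> b"
  shows "spectral_norm X \<le> b"
  unfolding spectral_norm_def
proof (rule cSUP_least)
  \<comment> \<open>A real supremum is bounded by its upper bounds only over a nonempty set; the
    zero vector is a member in every dimension.\<close>
  have "0\<^sub>v c \<in> {v \<in> carrier_vec (dim_col X). vec_norm2 v \<le> 1}" using assms(1) by simp
  then show "{v \<in> carrier_vec (dim_col X). vec_norm2 v \<le> 1} \<noteq> {}" by blast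
qed (use assms in auto)

lemma spectral_norm_nonneg [simp]: "0 \<le> spectral_norm X"
  using vec_norm2_mult_le_spectral_unit[of X "dim_row X" "dim_col X" "0\<^sub>v (dim_col X)"]
    order_trans[OF vec_norm2_nonneg] by auto

text \<open>By homogeneity, after scaling \<open>v\<close> to norm 1. For \<open>v\<close> of norm 0
  the Frobenius bound already gives 0.\<close>

lemma vec_norm2_mult_le_spectral:
  assumes X: "X \<in> carrier_mat r c" and v: "v \<in> carrier_vec c"
  shows "vec_norm2 (X *\<^sub>v v) \<le> spectral_norm X * vec_norm2 v"
proof (cases "vec_norm2 v = 0")
  case True
  then show ?thesis using vec_norm2_mult_le_frobenius[OF X v] by simp
next
  case False
  then have pos: "0 < vec_norm2 v" using vec_norm2_nonneg[of v] by linarith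
  define u where "u = inverse (vec_norm2 v) \<cdot>\<^sub>v v"
  have "vec_norm2 (X *\<^sub>v u) \<le> spectral_norm X"
    using v pos by (intro vec_norm2_mult_le_spectral_unit[OF X])
      (auto simp: u_def vec_norm2_smult)
  moreover have "X *\<^sub>v u = inverse (vec_norm2 v) \<cdot>\<^sub>v (X *\<^sub>v v)"
    using X v by (simp add: u_def mult_mat_vec)
  ultimately show ?thesis using pos by (simp add: vec_norm2_smult field_simps)
qed

text \<open>Division by \<open>x\<close>, with the case \<open>x = 0\<close> apart. It closes
  arguments that bound the square of a norm by a multiple of the same norm.\<close>

lemma le_of_square_le_mult:
  fixes x c :: real
  assumes "x\<^sup>2 \<le> c * x" "0 \<le> x" "0 \<le> c"
  shows "x \<le> c"
  using assms by (cases "x = 0") (auto simp: power2_eq_square)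

text \<open>For \<open>w = transpose_mat X *\<^sub>v v\<close> the square of the norm of
  \<open>w\<close> is \<open>v \<bullet> (X *\<^sub>v w)\<close>, hence at most the spectral norm of
  \<open>X\<close> times the norm of \<open>w\<close>. Applying this to
  \<open>transpose_mat X\<close> as well yields equality.\<close>

lemma spectral_norm_transpose_le: "spectral_norm (transpose_mat X) \<le> spectral_norm X"
proof (rule spectral_norm_le[of _ "dim_col X" "dim_row X"])
  fix v assume v: "v \<in> carrier_vec (dim_row X)" "vec_norm2 v \<le> 1"
  define w where "w = transpose_mat X *\<^sub>v v"
  have w: "w \<in> carrier_vec (dim_col X)" by (simp add: w_def carrier_vecI)
  have "(vec_norm2 w)\<^sup>2 = v \<bullet> (X *\<^sub>v w)"
    unfolding vec_norm2_square
    using transpose_vec_mult_scalar[OF carrier_mat_triv w v(1)] by (simp add: w_def)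
  also have "\<dots> \<le> vec_norm2 v * vec_norm2 (X *\<^sub>v w)"
    using abs_scalar_prod_le[OF v(1), of "X *\<^sub>v w"] by (simp add: carrier_vecI)
  also have "\<dots> \<le> vec_norm2 (X *\<^sub>v w)"
    using mult_right_mono[OF v(2), of "vec_norm2 (X *\<^sub>v w)"] by simp
  also have "\<dots> \<le> spectral_norm X * vec_norm2 w"
    by (rule vec_norm2_mult_le_spectral[OF carrier_mat_triv w])
  finally show "vec_norm2 (transpose_mat X *\<^sub>v v) \<le> spectral_norm X"
    by (fold w_def) (rule le_of_square_le_mult; simp)
qed auto

lemma spectral_norm_transpose [simp]: "spectral_norm (transpose_mat X) = spectral_norm X"
  using spectral_norm_transpose_le[of X] spectral_norm_transpose_le[of "transpose_mat X"] by simp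

lemma spectral_norm_mult_le:
  assumes X: "X \<in> carrier_mat r s" and Y: "Y \<in> carrier_mat s t"
  shows "spectral_norm (X * Y) \<le> spectral_norm X * spectral_norm Y"
proof (rule spectral_norm_le[OF mult_carrier_mat[OF X Y]])
  fix v :: "real vec" assume v: "v \<in> carrier_vec t" "vec_norm2 v \<le> 1"
  have "vec_norm2 (X * Y *\<^sub>v v) \<le> spectral_norm X * vec_norm2 (Y *\<^sub>v v)"
    using vec_norm2_mult_le_spectral[OF X] Y v X by (simp add: mult_mat_vec_carrier)
  also have "\<dots> \<le> spectral_norm X * spectral_norm Y"
    by (intro mult_left_mono vec_norm2_mult_le_spectral_unit[OF Y v]) simp
  finally show "vec_norm2 (X * Y *\<^sub>v v) \<le> spectral_norm X * spectral_norm Y" .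
qed

text \<open>The columns of \<open>X * Y\<close> are the images under \<open>X\<close> of the columns
  of \<open>Y\<close>, and each is stretched by at most \<open>spectral_norm X\<close>.\<close>

lemma frobenius_norm_mult_le:
  assumes X: "X \<in> carrier_mat r s" and Y: "Y \<in> carrier_mat s t"
  shows "frobenius_norm (X * Y) \<le> spectral_norm X * frobenius_norm Y"
proof -
  have "frobenius_norm (X * Y) = L2_set (\<lambda>j. vec_norm2 (X *\<^sub>v col Y j)) {..<t}"
    using X Y by (simp add: frobenius_norm_cols mult_mat_vec_def[symmetric] cong: L2_set_cong_simp)
  also have "\<dots> \<le> L2_set (\<lambda>j. spectral_norm X * vec_norm2 (col Y j)) {..<t}"
    using X Y by (intro L2_set_mono vec_norm2_mult_le_spectral[of _ r s]) auto
  also have "\<dots> = spectral_norm X * frobenius_norm Y"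
    using Y by (simp add: frobenius_norm_cols L2_set_right_distrib)
  finally show ?thesis .
qed

lemma spectral_norm_minus_le:
  assumes X: "X \<in> carrier_mat r c" and Y: "Y \<in> carrier_mat r c"
  shows "spectral_norm (X - Y) \<le> spectral_norm X + spectral_norm Y"
proof (rule spectral_norm_le[of _ r c])
  fix v :: "real vec" assume v: "v \<in> carrier_vec c" "vec_norm2 v \<le> 1"
  have "vec_norm2 ((X - Y) *\<^sub>v v) \<le> vec_norm2 (X *\<^sub>v v) + vec_norm2 (- (Y *\<^sub>v v))"
    using X Y v vec_norm2_add_le[of "X *\<^sub>v v" r "- (Y *\<^sub>v v)"]
    by (simp add: minus_mult_distrib_mat_vec mult_mat_vec_carrier
        minus_add_uminus_vec[of _ r])
  also have "\<dots> \<le> spectral_norm X + spectral_norm Y"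
    unfolding vec_norm2_uminus by (intro add_mono vec_norm2_mult_le_spectral_unit[OF X v]
        vec_norm2_mult_le_spectral_unit[OF Y v])
  finally show "vec_norm2 ((X - Y) *\<^sub>v v) \<le> spectral_norm X + spectral_norm Y" .
qed (use X Y in auto)

lemma frobenius_norm_minus_le:
  assumes X: "X \<in> carrier_mat r c" and Y: "Y \<in> carrier_mat r c"
  shows "frobenius_norm (X - Y) \<le> frobenius_norm X + frobenius_norm Y"
proof -
  let ?I = "{..<r} \<times> {..<c}"
  \<comment> \<open>The matrix is viewed as one long vector indexed by pairs, so that the triangle
    inequality for \<open>L2_set\<close> applies directly.\<close>
  have frob: "frobenius_norm Z = L2_set (\<lambda>p. Z $$ p) ?I" if "Z \<in> carrier_mat r c" for Z
    using that by (simp add: frobenius_norm_def L2_set_def sum.cartesian_product)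
  have "frobenius_norm (X - Y) = L2_set (\<lambda>p. X $$ p + - Y $$ p) ?I"
    using X Y by (subst frob) (auto intro: L2_set_cong)
  also have "\<dots> \<le> L2_set (\<lambda>p. X $$ p) ?I + L2_set (\<lambda>p. - Y $$ p) ?I"
    by (rule L2_set_triangle_ineq)
  also have "\<dots> = frobenius_norm X + frobenius_norm Y"
    using X Y by (simp add: frob L2_set_def)
  finally show ?thesis .
qed

lemma spectral_norm_mat_diag_le:
  assumes "\<And>i. i < n \<Longrightarrow> \<bar>f i\<bar> \<le> b" and "0 \<le> b"
  shows "spectral_norm (mat_diag n f) \<le> b"
proof (rule spectral_norm_le[OF mat_diag_dim])
  fix v :: "real vec" assume v: "v \<in> carrier_vec n" "vec_norm2 v \<le> 1"
  have "mat_diag n f *\<^sub>v v = Matrix.vec n (\<lambda>i. f i * v $ i)"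
  proof (rule eq_vecI)
    fix i assume i: "i < dim_vec (Matrix.vec n (\<lambda>i. f i * v $ i))"
    show "(mat_diag n f *\<^sub>v v) $ i = Matrix.vec n (\<lambda>i. f i * v $ i) $ i"
      using v i by (simp add: mat_diag_def scalar_prod_def mult_delta_left)
  qed (simp add: mat_diag_def)
  then have "vec_norm2 (mat_diag n f *\<^sub>v v) = L2_set (\<lambda>i. \<bar>f i * v $ i\<bar>) {..<n}"
    by (simp add: vec_norm2_eq_L2_set L2_set_def)
  also have "\<dots> \<le> L2_set (\<lambda>i. b * \<bar>v $ i\<bar>) {..<n}"
    using assms by (intro L2_set_mono) (auto simp: abs_mult mult_right_mono)
  also have "\<dots> = b * vec_norm2 v"
    using v assms by (simp add: vec_norm2_eq_L2_set L2_set_def power_mult_distrib real_sqrt_mult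
      flip: sum_distrib_left)
  also have "\<dots> \<le> b" using v assms by (simp add: mult_left_le)
  finally show "vec_norm2 (mat_diag n f *\<^sub>v v) \<le> b" .
qed

section \<open>Orthonormal columns and complementary projections\<close>

lemma orthonormal_cols_vec_norm2:
  assumes "orthonormal_cols X" "X \<in> carrier_mat r c" "v \<in> carrier_vec c"
  shows "vec_norm2 (X *\<^sub>v v) = vec_norm2 v"
proof -
  have "(X *\<^sub>v v) \<bullet> (X *\<^sub>v v) = (transpose_mat X *\<^sub>v (X *\<^sub>v v)) \<bullet> v"
    using assms by (simp add: transpose_vec_mult_scalar[of X r c] mult_mat_vec_carrier)
  also have "transpose_mat X *\<^sub>v (X *\<^sub>v v) = (transpose_mat X * X) *\<^sub>v v"
    using assms by simp
  also have "\<dots> = v"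
    using assms unfolding orthonormal_cols_def by simp
  finally show ?thesis by (simp add: vec_norm2_def)
qed

lemma spectral_norm_orthonormal_cols_le:
  assumes "orthonormal_cols X" "X \<in> carrier_mat r c"
  shows "spectral_norm X \<le> 1"
  using assms by (intro spectral_norm_le[OF assms(2)]) (simp add: orthonormal_cols_vec_norm2)

text \<open>The complementary projection is symmetric and idempotent, so
  \<open>\<parallel>H v\<parallel>\<^sup>2 = v \<bullet> H v \<le> \<parallel>v\<parallel> \<parallel>H v\<parallel>\<close>.\<close>

lemma spectral_norm_complement_le:
  assumes "orthonormal_cols Q" "Q \<in> carrier_mat r c"
  shows "spectral_norm (1\<^sub>m r - Q * transpose_mat Q) \<le> 1"
proof (rule spectral_norm_le[of _ r r])
  let ?H = "1\<^sub>m r - Q * transpose_mat Q"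
  show H: "?H \<in> carrier_mat r r" using assms by auto
  fix v :: "real vec" assume v: "v \<in> carrier_vec r" "vec_norm2 v \<le> 1"
  define w where "w = ?H *\<^sub>v v"
  have w: "w \<in> carrier_vec r" using H v by (simp add: w_def mult_mat_vec_carrier)
  have sym: "transpose_mat ?H = ?H"
    using assms by (simp add: transpose_minus[of _ r r] transpose_mult[of Q r c])
  define G where "G = Q * transpose_mat Q"
  have G: "G \<in> carrier_mat r r" using assms by (simp add: G_def)
  have "transpose_mat Q * (Q * transpose_mat Q) = (transpose_mat Q * Q) * transpose_mat Q"
    using assms by simp
  also have "\<dots> = transpose_mat Q" using assms by (simp add: orthonormal_cols_def)
  finally have "G * G = G" by (simp add: G_def mat_dim)
  then have "(1\<^sub>m r - G) * (1\<^sub>m r - G) = 1\<^sub>m r - G - (G - G)"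
    using G carrier_matD[OF G] by (simp add: mat_dim)
  also have "\<dots> = 1\<^sub>m r - G" using G by auto
  finally have "?H * ?H = ?H" by (simp add: G_def)
  then have "?H *\<^sub>v w = w"
    using H v by (simp add: w_def flip: assoc_mult_mat_vec[of _ r r _ r])
  then have "(vec_norm2 w)\<^sup>2 = v \<bullet> w"
    using transpose_vec_mult_scalar[OF H w v(1)] by (simp add: vec_norm2_square sym flip: w_def)
  also have "\<dots> \<le> vec_norm2 v * vec_norm2 w"
    using abs_scalar_prod_le[OF v(1) w] by linarith
  also have "\<dots> \<le> 1 * vec_norm2 w" using v by (intro mult_right_mono) auto
  finally show "vec_norm2 (?H *\<^sub>v v) \<le> 1"
    by (fold w_def) (rule le_of_square_le_mult; simp)
qed

section \<open>Generic invertibility of the sketch\<close>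

text \<open>Only one coordinate varies at a time, so univariate polynomials and the finiteness of
  their root sets suffice for the integration argument. The closure rules below cover the Leibniz
  formula of a determinant.\<close>

definition poly_in_each :: "'i set \<Rightarrow> (('i \<Rightarrow> real) \<Rightarrow> real) \<Rightarrow> bool" where
  "poly_in_each I f \<longleftrightarrow> (\<forall>i\<in>I. \<forall>x. \<exists>p. \<forall>t. f (x(i := t)) = poly p t)"

lemma poly_in_each_const: "poly_in_each I (\<lambda>x. c)"
  unfolding poly_in_each_def by (metis poly_pCons poly_0 mult_zero_right add.right_neutral)

lemma poly_in_each_component: "poly_in_each I (\<lambda>x. x j)"
  unfolding poly_in_each_def
proof (intro ballI allI)
  fix i and x :: "'a \<Rightarrow> real"
  have "\<forall>t. (x(i := t)) j = poly (if i = j then [:0, 1:] else [:x j:]) t" by simp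
  then show "\<exists>p. \<forall>t. (x(i := t)) j = poly p t" by blast
qed

lemma poly_in_each_add:
  assumes "poly_in_each I f" "poly_in_each I g"
  shows "poly_in_each I (\<lambda>x. f x + g x)"
  using assms unfolding poly_in_each_def by (metis poly_add)

lemma poly_in_each_mult:
  assumes "poly_in_each I f" "poly_in_each I g"
  shows "poly_in_each I (\<lambda>x. f x * g x)"
  using assms unfolding poly_in_each_def by (metis poly_mult)

lemma poly_in_each_sum:
  assumes "\<And>s. s \<in> S \<Longrightarrow> poly_in_each I (f s)"
  shows "poly_in_each I (\<lambda>x. \<Sum>s\<in>S. f s x)"
  using assms by (induction S rule: infinite_finite_induct)
    (simp_all add: poly_in_each_const poly_in_each_add)

lemma poly_in_each_prod:
  assumes "\<And>s. s \<in> S \<Longrightarrow> poly_in_each I (f s)"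
  shows "poly_in_each I (\<lambda>x. \<Prod>s\<in>S. f s x)"
  using assms by (induction S rule: infinite_finite_induct)
    (simp_all add: poly_in_each_const poly_in_each_mult)

text \<open>By Fubini, one coordinate at a time: off a null set of the other coordinates the function is
  a nonzero polynomial in the remaining one, which has finitely many roots.\<close>

lemma AE_PiM_poly_in_each_nonzero:
  fixes M :: "'i \<Rightarrow> real measure" and f :: "('i \<Rightarrow> real) \<Rightarrow> real"
  assumes "product_sigma_finite M" and "finite I"
    and sets: "\<And>i. sets (M i) = sets borel"
    and null: "\<And>i S. finite S \<Longrightarrow> emeasure (M i) S = 0"
    and "f \<in> borel_measurable (Pi\<^sub>M I M)"
    and "poly_in_each I f"
    and "x0 \<in> extensional I" "f x0 \<noteq> 0"
  shows "AE x in Pi\<^sub>M I M. f x \<noteq> 0"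
  using assms(2,5-)
proof (induction I arbitrary: f x0 rule: finite_induct)
  case empty
  \<comment> \<open>Over no coordinates the product space has the single point
    \<open>\<lambda>_. undefined\<close>, and extensionality forces \<open>x0\<close> to be that
    point.\<close>
  then show ?case by (intro AE_I2) (auto simp: space_PiM)
next
  case (insert i I)
  interpret product_sigma_finite M by fact
  note [measurable] = insert.prems(1)
  have space: "space (M j) = UNIV" for j using sets_eq_imp_space_eq[OF sets[of j]] by simp
  \<comment> \<open>Freezing coordinate \<open>i\<close> at its value in \<open>x0\<close> gives a
    function to which the induction hypothesis applies. Where \<open>g y\<close> is nonzero, the
    polynomial in coordinate \<open>i\<close> over \<open>y\<close> has a nonzero value at
    \<open>x0 i\<close> and is therefore not the zero polynomial.\<close>
  define g where "g = (\<lambda>y. f (y(i := x0 i)))"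
  have "(\<lambda>y. y(i := x0 i)) \<in> measurable (Pi\<^sub>M I M) (Pi\<^sub>M (insert i I) M)"
    using measurable_compose[OF measurable_Pair[OF measurable_ident measurable_const] measurable_add_dim]
    by (simp add: space)
  then have "g \<in> borel_measurable (Pi\<^sub>M I M)"
    unfolding g_def by measurable
  moreover have "poly_in_each I g"
    unfolding poly_in_each_def
  proof (intro ballI allI)
    fix j x assume "j \<in> I"
    then have "(x(j := t))(i := x0 i) = (x(i := x0 i))(j := t)" for t
      using insert.hyps by (auto simp: fun_upd_twist)
    then show "\<exists>p. \<forall>t. g (x(j := t)) = poly p t"
      using insert.prems(2) \<open>j \<in> I\<close> by (simp add: g_def poly_in_each_def)
  qed
  \<comment> \<open>The witness for the smaller index set must be \<open>undefined\<close> at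
    \<open>i\<close>; \<open>g\<close> overwrites that value by \<open>x0 i\<close>.\<close>
  moreover have "x0(i := undefined) \<in> extensional I"
    using insert.prems(3) by (auto simp: extensional_def)
  moreover have "g (x0(i := undefined)) \<noteq> 0"
    using insert.prems(4) by (simp add: g_def)
  ultimately have AE: "AE y in Pi\<^sub>M I M. g y \<noteq> 0" by (rule insert.IH)
  have zero: "(\<integral>\<^sup>+ t. indicator {x. f x = 0} (y(i := t)) \<partial>M i) = (0::ennreal)" if "g y \<noteq> 0" for y
  proof -
    obtain p where p: "\<And>t. f (y(i := t)) = poly p t"
      using insert.prems(2) unfolding poly_in_each_def by blast
    have "poly p (x0 i) \<noteq> 0" using that p by (simp add: g_def)
    then have fin: "finite {t. poly p t = 0}" by (intro poly_roots_finite) auto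
    then have meas: "{t. poly p t = 0} \<in> sets (M i)" unfolding sets by (intro borel_closed finite_imp_closed)
    have "(\<integral>\<^sup>+ t. indicator {x. f x = 0} (y(i := t)) \<partial>M i)
        = (\<integral>\<^sup>+ t. indicator {t. poly p t = 0} t \<partial>M i)"
      by (intro nn_integral_cong) (simp add: p indicator_def)
    also have "\<dots> = 0" using meas null[OF fin] by simp
    finally show ?thesis .
  qed
  let ?Z = "{x \<in> space (Pi\<^sub>M (insert i I) M). f x = 0}"
  have "emeasure (Pi\<^sub>M (insert i I) M) ?Z = (\<integral>\<^sup>+ x. indicator ?Z x \<partial>Pi\<^sub>M (insert i I) M)"
    by simp
  also have "\<dots> = (\<integral>\<^sup>+ y. (\<integral>\<^sup>+ t. indicator ?Z (y(i := t)) \<partial>M i) \<partial>Pi\<^sub>M I M)"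
    by (rule product_nn_integral_insert[OF insert.hyps]) measurable
  also have "\<dots> = (\<integral>\<^sup>+ y. 0 \<partial>Pi\<^sub>M I M)"
  proof (rule nn_integral_cong_AE)
    show "AE y in Pi\<^sub>M I M. (\<integral>\<^sup>+ t. indicator ?Z (y(i := t)) \<partial>M i) = (0::ennreal)"
      using AE
    proof eventually_elim
      case (elim y)
      \<comment> \<open>\<open>?Z\<close> additionally requires membership in the product space, so
        its indicator is the smaller one.\<close>
      have "(\<integral>\<^sup>+ t. indicator ?Z (y(i := t)) \<partial>M i)
          \<le> (\<integral>\<^sup>+ t. indicator {x. f x = 0} (y(i := t)) \<partial>M i)"
        by (intro nn_integral_mono) (simp add: indicator_def)
      then show ?case using zero[OF elim] by simp
    qed
  qed
  finally have "emeasure (Pi\<^sub>M (insert i I) M) ?Z = 0" by simp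
  then show ?case by (intro AE_I[of _ _ ?Z]) auto
qed

section \<open>Determinants of Gaussian sketches\<close>

lemma density_std_normal_finite_null:
  assumes "finite S"
  shows "emeasure (density lborel std_normal_density) S = 0"
proof -
  have "S \<in> null_sets lborel" using assms by (rule finite_imp_null_set_lborel)
  then have "AE x in lborel. x \<notin> S" by (rule AE_not_in)
  then have "S \<in> null_sets (density lborel std_normal_density)"
    using \<open>S \<in> null_sets lborel\<close> by (subst null_sets_density_iff) auto
  then show ?thesis by auto
qed

lemma invertible_mat_iff_det:
  fixes A :: "'a :: field mat"
  assumes A: "A \<in> carrier_mat n n"
  shows "invertible_mat A \<longleftrightarrow> det A \<noteq> 0"
proof
  assume "invertible_mat A"
  then obtain B where B: "A * B = 1\<^sub>m n" "B * A = 1\<^sub>m (dim_row B)"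
    using A by (auto simp: invertible_mat_def inverts_mat_def)
  \<comment> \<open>\<open>invertible_mat\<close> does not fix the shape of the inverse; it is read
    off from the two products.\<close>
  have "dim_col B = n"
    using arg_cong[OF B(1), of dim_col] by simp
  moreover have "dim_row B = n"
    using arg_cong[OF B(2), of dim_col] A by simp
  ultimately have "B \<in> carrier_mat n n" by (intro carrier_matI)
  then have "det A * det B = 1"
    using det_mult[OF A, of B] B(1) by simp
  then show "det A \<noteq> 0" by auto
next
  assume "det A \<noteq> 0"
  from det_non_zero_imp_unit[OF A this, of "()"] show "invertible_mat A"
    using A by (auto simp: Units_def ring_mat_def invertible_mat_def inverts_mat_def)
qed

text \<open>By independence the joint law of the entries is a product of normal laws, under which
  the zero set of a nonzero polynomial is null. All entries of \<open>\<Omega>\<close>, not only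
  those of its first \<open>k\<close> columns, serve as coordinates, which matches the index set of
  the independence assumption.\<close>

lemma AE_det_gaussian_nonzero:
  assumes g: "std_gaussian_matrix M m n \<Omega>" and k: "k \<le> n" "0 < k" "k \<le> m"
    and U: "U \<in> carrier_mat m k" "orthonormal_cols U"
  shows "AE \<omega> in M. det (transpose_mat U * first_cols k (\<Omega> \<omega>)) \<noteq> 0"
    and "(\<lambda>\<omega>. det (transpose_mat U * first_cols k (\<Omega> \<omega>))) \<in> borel_measurable M"
proof -
  interpret prob_space M using g by (simp add: std_gaussian_matrix_def)
  \<comment> \<open>The Leibniz formula for the determinant of \<open>transpose_mat U\<close> times
    the matrix with entries \<open>x\<close>. Since \<open>p\<close> permutes the indices below
    \<open>k\<close>, only the first \<open>k\<close> columns of \<open>x\<close> are read.\<close>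
  define f :: "(nat \<times> nat \<Rightarrow> real) \<Rightarrow> real" where
    "f x = (\<Sum>p | p permutes {0..<k}. signof p * (\<Prod>i=0..<k. \<Sum>l<m. U $$ (l, i) * x (l, p i)))" for x
  define X where "X = (\<lambda>(i, j) \<omega>. \<Omega> \<omega> $$ (i, j))"
  define I where "I = {..<m} \<times> {..<n}"
  define D where "D = density lborel std_normal_density"
  have perm: "p i < k" if "p permutes {0..<k}" "i < k" for p i
    using permutes_in_image[OF that(1), of i] that(2) by simp
  have det_eq: "det (transpose_mat U * Matrix.mat m k x) = f x" for x
    using U unfolding f_def
    by (subst det_def'[of _ k])
      (auto simp: scalar_prod_def lessThan_atLeast0 perm intro!: sum.cong prod.cong)
  \<comment> \<open>Nonemptiness of \<open>I\<close> is a premise of the characterisation of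
    independence by product measures.\<close>
  have "(0, 0) \<in> I" using k by (simp add: I_def)
  then have I: "finite I" "I \<noteq> {}" by (auto simp: I_def)
  have fX: "det (transpose_mat U * first_cols k (\<Omega> \<omega>)) = f (\<lambda>i\<in>I. X i \<omega>)" if "\<omega> \<in> space M" for \<omega>
  proof -
    have "\<Omega> \<omega> \<in> carrier_mat m n" using g that by (simp add: std_gaussian_matrix_def)
    then have "first_cols k (\<Omega> \<omega>) = Matrix.mat m k (\<lambda>i\<in>I. X i \<omega>)"
      using k by (intro eq_matI) (auto simp: first_cols_def I_def X_def)
    then show ?thesis by (simp add: det_eq)
  qed
  have X: "X i \<in> borel_measurable M" "distr M borel (X i) = D" if "i \<in> I" for i
  proof -
    have d: "distributed M lborel (X i) std_normal_density"
      using g that by (auto simp: std_gaussian_matrix_def I_def X_def)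
    show "X i \<in> borel_measurable M" using distributed_measurable[OF d] by simp
    \<comment> \<open>\<open>distributed\<close> speaks of the law on \<open>lborel\<close> and
      independence of the law on \<open>borel\<close>; the two have the same measurable
      sets.\<close>
    have "distr M borel (X i) = distr M lborel (X i)" by (rule distr_cong) auto
    then show "distr M borel (X i) = D" using distributed_distr_eq_density[OF d] by (simp add: D_def)
  qed
  have indep: "indep_vars (\<lambda>_. borel) X I"
    using g unfolding std_gaussian_matrix_def X_def I_def by blast
  have f_meas: "f \<in> borel_measurable (Pi\<^sub>M I (\<lambda>_. borel))"
    unfolding f_def using k
    by (intro borel_measurable_sum borel_measurable_times borel_measurable_prod borel_measurable_const
        measurable_component_singleton) (auto simp: I_def intro: less_le_trans[OF perm])
  have X_meas: "(\<lambda>\<omega>. \<lambda>i\<in>I. X i \<omega>) \<in> measurable M (Pi\<^sub>M I (\<lambda>_. borel))"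
    using X by (intro measurable_restrict) auto
  have "AE x in Pi\<^sub>M I (\<lambda>_. D). f x \<noteq> 0"
  proof (rule AE_PiM_poly_in_each_nonzero)
    have "prob_space D" unfolding D_def by (rule prob_space_normal_density) simp
    then show "product_sigma_finite (\<lambda>_. D)"
      by (simp add: product_sigma_finite_def prob_space_imp_sigma_finite)
    show "sets D = sets borel" by (simp add: D_def)
    show "emeasure D S = 0" if "finite S" for S
      unfolding D_def by (rule density_std_normal_finite_null[OF that])
    have "sets (Pi\<^sub>M I (\<lambda>_. D)) = sets (Pi\<^sub>M I (\<lambda>_. borel))"
      by (intro sets_PiM_cong) (simp_all add: D_def)
    then show "f \<in> borel_measurable (Pi\<^sub>M I (\<lambda>_. D))"
      using f_meas by (simp cong: measurable_cong_sets)
    show "poly_in_each I f"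
      unfolding f_def by (intro poly_in_each_sum poly_in_each_prod poly_in_each_mult
          poly_in_each_const poly_in_each_component)
    \<comment> \<open>The witness: the sketch equal to \<open>U\<close> itself has determinant
      \<open>det (transpose_mat U * U) = 1\<close>. The columns of \<open>x0\<close> from
      \<open>k\<close> on hold unspecified values, which \<open>f\<close> does not read.\<close>
    define x0 where "x0 = restrict (\<lambda>p. U $$ p) I"
    have "Matrix.mat m k x0 = U"
      using U k by (intro eq_matI) (auto simp: x0_def I_def)
    then have "f x0 = det (transpose_mat U * U)" using det_eq[of x0] by simp
    then show "f x0 \<noteq> 0" using U by (simp add: orthonormal_cols_def)
    show "x0 \<in> extensional I" by (simp add: x0_def)
  qed (rule I)
  also have "Pi\<^sub>M I (\<lambda>_. D) = Pi\<^sub>M I (\<lambda>i. distr M borel (X i))"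
    by (intro PiM_cong) (auto simp: X)
  also have "\<dots> = distr M (Pi\<^sub>M I (\<lambda>_. borel)) (\<lambda>\<omega>. \<lambda>i\<in>I. X i \<omega>)"
    using indep_vars_iff_distr_eq_PiM'[OF I(2), of X "\<lambda>_. borel"] X(1) indep by simp
  finally have "AE \<omega> in M. f (\<lambda>i\<in>I. X i \<omega>) \<noteq> 0"
    by (rule AE_distrD[OF X_meas])
  then show "AE \<omega> in M. det (transpose_mat U * first_cols k (\<Omega> \<omega>)) \<noteq> 0"
    by (rule AE_mp) (auto intro!: AE_I2 simp: fX)
  show "(\<lambda>\<omega>. det (transpose_mat U * first_cols k (\<Omega> \<omega>))) \<in> borel_measurable M"
    using measurable_compose[OF X_meas f_meas] by (simp add: fX cong: measurable_cong)
qed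

section \<open>Splitting the singular value decomposition\<close>

definition drop_cols :: "nat \<Rightarrow> 'a mat \<Rightarrow> 'a mat" where
  "drop_cols k X = Matrix.mat (dim_row X) (dim_col X - k) (\<lambda>(i, j). X $$ (i, j + k))"

lemma first_drop_dims [simp]:
  "dim_row (first_cols k X) = dim_row X" "dim_col (first_cols k X) = k"
  "dim_row (drop_cols k X) = dim_row X" "dim_col (drop_cols k X) = dim_col X - k"
  by (simp_all add: first_cols_def drop_cols_def)

lemma sum_split_at:
  fixes f :: "nat \<Rightarrow> 'a :: comm_monoid_add"
  assumes "k \<le> n"
  shows "(\<Sum>l=0..<n. f l) = (\<Sum>l=0..<k. f l) + (\<Sum>l=0..<n-k. f (l + k))"
proof -
  have "(\<Sum>l=0..<n. f l) = (\<Sum>l=0..<k. f l) + (\<Sum>l=k..<n. f l)"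
    using assms by (simp add: sum.atLeastLessThan_concat)
  also have "(\<Sum>l=k..<n. f l) = (\<Sum>l=0..<n-k. f (l + k))"
    using assms sum.shift_bounds_nat_ivl[of f 0 k "n - k"] by simp
  finally show ?thesis .
qed

lemma first_cols_mult:
  assumes "dim_col X = dim_row Y" "k \<le> dim_col Y"
  shows "first_cols k (X * Y) = X * first_cols k Y"
  using assms by (intro eq_matI) (auto simp: first_cols_def scalar_prod_def)

text \<open>The first \<open>k\<close> columns of an upper triangular matrix vanish below row
  \<open>k\<close>, so they combine only the first \<open>k\<close> columns of \<open>X\<close>.
  This is how unpivoted QR keeps the range of the leading columns.\<close>

lemma first_cols_mult_upper_triangular:
  fixes X R :: "real mat"
  assumes "dim_col X = dim_row R" "k \<le> dim_col R" "k \<le> dim_row R" "upper_triangular R"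
  shows "first_cols k (X * R) = first_cols k X * first_rows k (first_cols k R)"
proof (rule eq_matI)
  fix i j
  assume ij: "i < dim_row (first_cols k X * first_rows k (first_cols k R))"
    "j < dim_col (first_cols k X * first_rows k (first_cols k R))"
  then have i: "i < dim_row X" and j: "j < k" by (auto simp: first_rows_def)
  have "R $$ (l + k, j) = 0" if "l < dim_row R - k" for l
    using upper_triangularD[OF assms(4), of j "l + k"] that j by simp
  then show "first_cols k (X * R) $$ (i, j)
      = (first_cols k X * first_rows k (first_cols k R)) $$ (i, j)"
    using i j assms by (simp add: first_cols_def first_rows_def scalar_prod_def
        sum_split_at[OF assms(3)])
qed (auto simp: first_rows_def)

lemma first_rows_transpose_mult:
  assumes "dim_row X = dim_row Y" "k \<le> dim_col X"
  shows "first_rows k (transpose_mat X * Y) = transpose_mat (first_cols k X) * Y"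
  using assms by (intro eq_matI) (auto simp: first_cols_def first_rows_def scalar_prod_def)

lemma drop_rows_transpose_mult:
  assumes "dim_row X = dim_row Y"
  shows "drop_rows k (transpose_mat X * Y) = transpose_mat (drop_cols k X) * Y"
  using assms by (intro eq_matI) (auto simp: drop_cols_def drop_rows_def scalar_prod_def)

lemma mult_diag_split:
  fixes X Y :: "real mat"
  assumes "X \<in> carrier_mat r n" "Y \<in> carrier_mat c n" "k \<le> n"
  shows "X * mat_diag n f * transpose_mat Y =
    first_cols k X * mat_diag k f * transpose_mat (first_cols k Y) +
    drop_cols k X * mat_diag (n - k) (\<lambda>i. f (i + k)) * transpose_mat (drop_cols k Y)"
proof -
  have "first_cols k X \<in> carrier_mat r k" "drop_cols k X \<in> carrier_mat r (n - k)"
    using assms by auto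
  then show ?thesis
    using assms by (intro eq_matI)
      (auto simp: mat_diag_mult_right[of _ r] scalar_prod_def sum_split_at[OF assms(3)]
        first_cols_def drop_cols_def)
qed

text \<open>All four claims compare blocks of \<open>transpose_mat X * X\<close> with blocks of the
  identity.\<close>

lemma orthonormal_cols_split:
  assumes "orthonormal_cols X" "k \<le> dim_col X"
  shows "orthonormal_cols (first_cols k X)" "orthonormal_cols (drop_cols k X)"
    "transpose_mat (first_cols k X) * drop_cols k X = 0\<^sub>m k (dim_col X - k)"
    "transpose_mat (drop_cols k X) * first_cols k X = 0\<^sub>m (dim_col X - k) k"
proof -
  have ip: "(\<Sum>l = 0..<dim_row X. X $$ (l, i) * X $$ (l, j)) = (if i = j then 1 else 0)"
    if "i < dim_col X" "j < dim_col X" for i j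
  proof -
    have "(transpose_mat X * X) $$ (i, j) = (1\<^sub>m (dim_col X) :: real mat) $$ (i, j)"
      using assms(1) by (simp add: orthonormal_cols_def)
    then show ?thesis using that by (simp add: scalar_prod_def)
  qed
  show "orthonormal_cols (first_cols k X)" "orthonormal_cols (drop_cols k X)"
    unfolding orthonormal_cols_def using assms(2)
    by (intro eq_matI; simp add: first_cols_def drop_cols_def scalar_prod_def ip)+
  show "transpose_mat (first_cols k X) * drop_cols k X = 0\<^sub>m k (dim_col X - k)"
    "transpose_mat (drop_cols k X) * first_cols k X = 0\<^sub>m (dim_col X - k) k"
    using assms(2)
    by (intro eq_matI; simp add: first_cols_def drop_cols_def scalar_prod_def ip)+
qed

lemma mult_cancel_left_dim:
  fixes X Y Z :: "'a :: semiring_0 mat"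
  assumes "X * Y = W" "dim_col X = dim_row Y" "dim_col Y = dim_row Z"
  shows "X * (Y * Z) = W * Z"
  using assms by (simp flip: mult_assoc_dim)

text \<open>Products normalised by \<open>mat_dim\<close> are nested to the right, which hides
  \<open>transpose_mat X * X\<close>. This rule and the next cancel such factors inside that normal
  form.\<close>

lemma orthonormal_cols_cancel:
  assumes "orthonormal_cols X" "dim_row Z = dim_col X"
  shows "transpose_mat X * (X * Z) = Z"
proof -
  have "transpose_mat X * (X * Z) = 1\<^sub>m (dim_col X) * Z"
    using assms by (intro mult_cancel_left_dim) (simp_all add: orthonormal_cols_def)
  then show ?thesis using assms(2) by (simp add: left_mult_one_mat')
qed

lemma orthogonal_cols_cancel:
  assumes "transpose_mat X * Y = 0\<^sub>m r c" "dim_row X = dim_row Y" "dim_row Z = dim_col Y"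
  shows "transpose_mat X * (Y * Z) = 0\<^sub>m r (dim_col Z)"
proof -
  have "c = dim_col Y" using arg_cong[OF assms(1), of dim_col] by simp
  moreover have "transpose_mat X * (Y * Z) = 0\<^sub>m r c * Z"
    using assms by (intro mult_cancel_left_dim) simp_all
  ultimately show ?thesis using assms(3) by (simp add: left_mult_zero_mat')
qed

text \<open>The form is symmetric in the left and right singular blocks, so one argument serves both
  \<open>A\<close> and \<open>transpose_mat A\<close>.\<close>

definition split_svd :: "nat \<Rightarrow> nat \<Rightarrow> nat \<Rightarrow> nat \<Rightarrow> real mat \<Rightarrow> real mat \<Rightarrow> real mat \<Rightarrow>
    real mat \<Rightarrow> real mat \<Rightarrow> real mat \<Rightarrow> real mat \<Rightarrow> bool" where
  "split_svd m n k l A U1 U2 S1 S2 V1 V2 \<longleftrightarrow>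
     U1 \<in> carrier_mat m k \<and> U2 \<in> carrier_mat m l \<and> V1 \<in> carrier_mat n k \<and> V2 \<in> carrier_mat n l \<and>
     S1 \<in> carrier_mat k k \<and> S2 \<in> carrier_mat l l \<and>
     orthonormal_cols U1 \<and> orthonormal_cols U2 \<and> orthonormal_cols V1 \<and> orthonormal_cols V2 \<and>
     transpose_mat U1 * U2 = 0\<^sub>m k l \<and> transpose_mat U2 * U1 = 0\<^sub>m l k \<and>
     transpose_mat V1 * V2 = 0\<^sub>m k l \<and> transpose_mat V2 * V1 = 0\<^sub>m l k \<and>
     A = U1 * S1 * transpose_mat V1 + U2 * S2 * transpose_mat V2"

lemma split_svd_transpose:
  assumes "split_svd m n k l A U1 U2 S1 S2 V1 V2"
    and "transpose_mat S1 = S1" "transpose_mat S2 = S2"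
  shows "split_svd n m k l (transpose_mat A) V1 V2 S1 S2 U1 U2"
  using assms unfolding split_svd_def by (auto simp: mat_dim)

text \<open>One step of the power iteration: right singular blocks turn into left ones, and the
  diagonal blocks gain a factor \<open>S1\<close> or \<open>S2\<close>. The cross terms vanish by
  orthogonality.\<close>

lemma split_svd_mult:
  fixes A :: "real mat"
  assumes svd: "split_svd m n k l A U1 U2 S1 S2 V1 V2"
    and "D1 \<in> carrier_mat k k" "D2 \<in> carrier_mat l l" "T \<in> carrier_mat k q" "B \<in> carrier_mat l q"
  shows "A * (V1 * D1 * T + V2 * D2 * B) = U1 * (S1 * D1) * T + U2 * (S2 * D2) * B"
proof -
  have dims [simp]: "dim_row U1 = m" "dim_col U1 = k" "dim_row U2 = m" "dim_col U2 = l"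
    "dim_row V1 = n" "dim_col V1 = k" "dim_row V2 = n" "dim_col V2 = l"
    "dim_row S1 = k" "dim_col S1 = k" "dim_row S2 = l" "dim_col S2 = l"
    "dim_row D1 = k" "dim_col D1 = k" "dim_row D2 = l" "dim_col D2 = l"
    "dim_row T = k" "dim_col T = q" "dim_row B = l" "dim_col B = q"
    and A: "A = U1 * S1 * transpose_mat V1 + U2 * S2 * transpose_mat V2"
    using assms by (auto simp: split_svd_def)
  have "orthonormal_cols V1" "orthonormal_cols V2"
    "transpose_mat V1 * V2 = 0\<^sub>m k l" "transpose_mat V2 * V1 = 0\<^sub>m l k"
    using svd by (simp_all add: split_svd_def)
  note [simp] = orthonormal_cols_cancel[OF this(1)] orthonormal_cols_cancel[OF this(2)]
    orthogonal_cols_cancel[OF this(3)] orthogonal_cols_cancel[OF this(4)]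
  show ?thesis by (simp add: A mat_dim)
qed

text \<open>The facts shared by both norms, so that the bounds are derived once for a norm
  \<open>N\<close>. In a product the left factor is always measured in the spectral norm.\<close>

lemma mat_norm_facts:
  assumes "N \<in> {spectral_norm, frobenius_norm}"
  shows mat_norm_nonneg: "0 \<le> N X"
    and mat_norm_transpose: "N (transpose_mat X) = N X"
    and mat_norm_minus_le: "X \<in> carrier_mat r c \<Longrightarrow> Y \<in> carrier_mat r c \<Longrightarrow> N (X - Y) \<le> N X + N Y"
    and mat_norm_mult_le: "X \<in> carrier_mat r s \<Longrightarrow> Y \<in> carrier_mat s t \<Longrightarrow>
      N (X * Y) \<le> spectral_norm X * N Y"
  using assms spectral_norm_minus_le frobenius_norm_minus_le
    spectral_norm_mult_le frobenius_norm_mult_le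
  by auto

section \<open>Norm bounds for the residual of a projection\<close>

lemma mat_norm_contraction_mult_le:
  assumes N: "N \<in> {spectral_norm, frobenius_norm}"
    and X: "X \<in> carrier_mat r s" and Y: "Y \<in> carrier_mat s t" and "spectral_norm X \<le> 1"
  shows "N (X * Y) \<le> N Y"
  using mat_norm_mult_le[OF N X Y] mult_right_mono[OF assms(4) mat_norm_nonneg[OF N, of Y]] by simp

text \<open>If \<open>H\<close> annihilates the graph \<open>U1 + U2 F\<close>, then
  \<open>H A = H U2 (S2 V2\<^sup>T - F S1 V1\<^sup>T)\<close>, and \<open>S1 V1\<^sup>T = U1\<^sup>T A\<close>.\<close>

lemma mat_norm_annihilated_graph_le:
  assumes N: "N \<in> {spectral_norm, frobenius_norm}"
    and svd: "split_svd m n k l A U1 U2 S1 S2 V1 V2"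
    and H: "H \<in> carrier_mat m m" "spectral_norm H \<le> 1"
    and F: "F \<in> carrier_mat l k"
    and HU: "H * U1 + H * U2 * F = 0\<^sub>m m k"
  shows "N (H * A) \<le> N S2 + spectral_norm F * N A"
proof -
  have carriers: "U1 \<in> carrier_mat m k" "U2 \<in> carrier_mat m l" "V1 \<in> carrier_mat n k"
    "V2 \<in> carrier_mat n l" "S1 \<in> carrier_mat k k" "S2 \<in> carrier_mat l l" "A \<in> carrier_mat m n"
    and A: "A = U1 * S1 * transpose_mat V1 + U2 * S2 * transpose_mat V2"
    using svd by (auto simp: split_svd_def)
  then have dims [simp]: "dim_row U1 = m" "dim_col U1 = k" "dim_row U2 = m" "dim_col U2 = l"
    "dim_row V1 = n" "dim_col V1 = k" "dim_row V2 = n" "dim_col V2 = l"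
    "dim_row S1 = k" "dim_col S1 = k" "dim_row S2 = l" "dim_col S2 = l"
    "dim_row H = m" "dim_col H = m" "dim_row F = l" "dim_col F = k"
    "dim_row A = m" "dim_col A = n"
    using H F by auto
  have U: "orthonormal_cols U1" "transpose_mat U1 * U2 = 0\<^sub>m k l" "orthonormal_cols U2" "orthonormal_cols V2"
    using svd by (simp_all add: split_svd_def)
  have UA: "transpose_mat U1 * A = S1 * transpose_mat V1"
    by (simp add: A mat_dim orthonormal_cols_cancel[OF U(1)] orthogonal_cols_cancel[OF U(2)])
  let ?X = "S1 * transpose_mat V1" and ?Y = "H * (U2 * (S2 * transpose_mat V2))"
  have "(H * U1 + H * U2 * F) * ?X = 0\<^sub>m m n" by (simp add: HU)
  then have sum0: "H * (U1 * ?X) + H * (U2 * (F * ?X)) = 0\<^sub>m m n" by (simp add: mat_dim)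
  have "H * A = H * (U1 * ?X) + ?Y" by (simp add: A mat_dim)
  also have "\<dots> = ?Y - H * (U2 * (F * ?X))"
  proof (rule eq_matI)
    fix i j assume "i < dim_row (?Y - H * (U2 * (F * ?X)))" "j < dim_col (?Y - H * (U2 * (F * ?X)))"
    then have ij: "i < m" "j < n" by auto
    have "(H * (U1 * ?X) + H * (U2 * (F * ?X))) $$ (i, j) = 0"
      unfolding sum0 using ij by simp
    then show "(H * (U1 * ?X) + ?Y) $$ (i, j) = (?Y - H * (U2 * (F * ?X))) $$ (i, j)"
      using ij by (simp del: index_mult_mat(1))
  qed auto
  also have "\<dots> = H * (U2 * (S2 * transpose_mat V2 - F * (transpose_mat U1 * A)))"
    unfolding UA by (simp add: mat_dim)
  finally have "N (H * A) = N \<dots>" by simp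
  also have "\<dots> \<le> N (U2 * (S2 * transpose_mat V2 - F * (transpose_mat U1 * A)))"
    by (intro mat_norm_contraction_mult_le[OF N H(1) _ H(2), of _ n] carrier_matI) simp_all
  also have "\<dots> \<le> N (S2 * transpose_mat V2 - F * (transpose_mat U1 * A))"
    by (intro mat_norm_contraction_mult_le[OF N carriers(2) _
          spectral_norm_orthonormal_cols_le[OF U(3) carriers(2)], of _ n] carrier_matI) simp_all
  also have "\<dots> \<le> N (S2 * transpose_mat V2) + N (F * (transpose_mat U1 * A))"
    by (intro mat_norm_minus_le[OF N, of _ l n] carrier_matI) simp_all
  \<comment> \<open>The product bound removes contractions on the left only, so the right factor is
    moved there by transposition.\<close>
  also have "N (S2 * transpose_mat V2) = N (V2 * transpose_mat S2)"
    using mat_norm_transpose[OF N, of "V2 * transpose_mat S2"] by (simp add: mat_dim)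
  also have "\<dots> \<le> N (transpose_mat S2)"
    by (intro mat_norm_contraction_mult_le[OF N carriers(4) _
          spectral_norm_orthonormal_cols_le[OF U(4) carriers(4)], of _ l] carrier_matI) simp_all
  also have "\<dots> = N S2" by (rule mat_norm_transpose[OF N])
  also have "N (F * (transpose_mat U1 * A)) \<le> spectral_norm F * N (transpose_mat U1 * A)"
    by (intro mat_norm_mult_le[OF N F, of _ n] carrier_matI) simp_all
  also have "\<dots> \<le> spectral_norm F * N A"
    using spectral_norm_orthonormal_cols_le[OF U(1) carriers(1)] carriers
    by (intro mult_left_mono mat_norm_contraction_mult_le[OF N, of _ k m _ n]) simp_all
  finally show ?thesis by simp
qed

text \<open>The projection annihilates everything in the range of \<open>Q\<close>. Multiplying
  \<open>QW\<close> on the right by \<open>T'\<close> and the inverse of the leading diagonal block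
  turns its left side into the graph \<open>U1 + U2 * F\<close>. General diagonals \<open>f\<close>
  and \<open>g\<close> cover both the squares and the cubes of the singular values.\<close>

lemma residual_norm_le:
  assumes N: "N \<in> {spectral_norm, frobenius_norm}"
    and svd: "split_svd m n k l A U1 U2 S1 S2 V1 V2"
    and T: "T \<in> carrier_mat k k" "T' \<in> carrier_mat k k" "T * T' = 1\<^sub>m k"
    and B: "B \<in> carrier_mat l k"
    and Q: "Q \<in> carrier_mat m k" "orthonormal_cols Q" and W: "W \<in> carrier_mat k k"
    and QW: "U1 * mat_diag k f * T + U2 * mat_diag l g * B = Q * W"
    and f: "\<And>i. i < k \<Longrightarrow> a \<le> f i" "0 < a"
    and g: "\<And>i. i < l \<Longrightarrow> \<bar>g i\<bar> \<le> b" "0 \<le> b"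
  shows "N ((1\<^sub>m m - Q * transpose_mat Q) * A) \<le> N S2 + N A * (b / a) * spectral_norm (B * T')"
proof -
  define H where "H = 1\<^sub>m m - Q * transpose_mat Q"
  \<comment> \<open>The inverse of the leading diagonal block, whose entries are at least
    \<open>a > 0\<close>; its spectral norm is at most \<open>inverse a\<close>.\<close>
  define D where "D = mat_diag k (\<lambda>i. inverse (f i))"
  define F where "F = mat_diag l g * (B * T' * D)"
  have carriers: "U1 \<in> carrier_mat m k" "U2 \<in> carrier_mat m l" "H \<in> carrier_mat m m"
    "D \<in> carrier_mat k k"
    using svd Q by (auto simp: split_svd_def H_def D_def)
  then have F: "F \<in> carrier_mat l k"
    using T B by (intro carrier_matI) (simp_all add: F_def)
  have dims [simp]: "dim_row U1 = m" "dim_col U1 = k" "dim_row U2 = m" "dim_col U2 = l"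
    "dim_row H = m" "dim_col H = m" "dim_row D = k" "dim_col D = k"
    "dim_row T = k" "dim_col T = k" "dim_row T' = k" "dim_col T' = k"
    "dim_row B = l" "dim_col B = k" "dim_row Q = m" "dim_col Q = k" "dim_row W = k" "dim_col W = k"
    using carriers T B Q W by auto
  have fD: "mat_diag k f * D = 1\<^sub>m k"
  proof -
    have "mat_diag k (\<lambda>i. f i * inverse (f i)) = mat_diag k (\<lambda>i. 1)"
      using f by (intro eq_matI) (force simp: mat_diag_def)+
    then show ?thesis by (simp add: D_def)
  qed
  have "transpose_mat Q * (Q * W) = W"
    using Q W by (intro orthonormal_cols_cancel) auto
  then have "H * (Q * W) = 0\<^sub>m m k"
    by (simp add: H_def mat_dim) (auto intro!: eq_matI)
  then have "H * (U1 * mat_diag k f * T + U2 * mat_diag l g * B) * (T' * D) = 0\<^sub>m m k"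
    by (simp add: QW)
  moreover have "T * (T' * D) = D"
    using mult_cancel_left_dim[OF T(3), of D] by (simp add: left_mult_one_mat')
  ultimately have HU: "H * U1 + H * U2 * F = 0\<^sub>m m k"
    by (simp add: mat_dim F_def fD)
  have "\<bar>inverse (f i)\<bar> \<le> inverse a" if "i < k" for i
    using f(1)[OF that] f(2) by (simp add: le_imp_inverse_le)
  then have "spectral_norm D \<le> inverse a"
    unfolding D_def using f(2) by (intro spectral_norm_mat_diag_le) auto
  have "spectral_norm F \<le> spectral_norm (mat_diag l g) * (spectral_norm (B * T') * spectral_norm D)"
    unfolding F_def
    by (intro order_trans[OF spectral_norm_mult_le[of _ l l _ k]] mult_left_mono
        spectral_norm_mult_le[of _ l k _ k] carrier_matI) simp_all
  also have "\<dots> \<le> b * (spectral_norm (B * T') * inverse a)"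
    using g \<open>spectral_norm D \<le> inverse a\<close>
    by (intro mult_mono spectral_norm_mat_diag_le) auto
  finally have "spectral_norm F * N A \<le> b * (spectral_norm (B * T') * inverse a) * N A"
    by (intro mult_right_mono mat_norm_nonneg[OF N])
  moreover have "spectral_norm H \<le> 1"
    unfolding H_def by (rule spectral_norm_complement_le[OF Q(2,1)])
  then have "N (H * A) \<le> N S2 + spectral_norm F * N A"
    using carriers(3) F HU by (intro mat_norm_annihilated_graph_le[OF N svd])
  ultimately show ?thesis by (simp add: H_def field_simps)
qed

section \<open>Rand-QLP\<close>

text \<open>\<open>W\<close> is the leading block of \<open>R\<close> and may be singular: what
  matters is that the first \<open>k\<close> columns of \<open>X\<close> lie in the range of the
  first \<open>k\<close> columns of \<open>Q\<close>.\<close>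

lemma qr_factorization_first_cols:
  assumes "qr_factorization X Q R" "k \<le> dim_col X"
  obtains W where "W \<in> carrier_mat k k" "first_cols k X = first_cols k Q * W"
    and "first_cols k Q \<in> carrier_mat (dim_row X) k" "orthonormal_cols (first_cols k Q)"
proof
  have Q: "Q \<in> carrier_mat (dim_row X) (dim_col X)" "orthonormal_cols Q"
    and R: "R \<in> carrier_mat (dim_col X) (dim_col X)" "upper_triangular R"
    and X: "X = Q * R"
    using assms(1) unfolding qr_factorization_def by blast+
  let ?W = "first_rows k (first_cols k R)"
  show "?W \<in> carrier_mat k k" by (simp add: first_rows_def)
  show "first_cols k X = first_cols k Q * ?W"
    unfolding X using assms(2) carrier_matD[OF Q(1)] carrier_matD[OF R(1)]
    by (intro first_cols_mult_upper_triangular R(2)) simp_all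
  show "first_cols k Q \<in> carrier_mat (dim_row X) k"
    using carrier_matD[OF Q(1)] by (intro carrier_matI) simp_all
  show "orthonormal_cols (first_cols k Q)"
    using assms(2) carrier_matD[OF Q(1)] by (intro orthonormal_cols_split Q(2)) simp
qed

text \<open>Diagonals are indexed from 0 and singular values from 1, hence the shifts
  \<open>i + 1\<close> and \<open>k + 1 + i\<close>.\<close>

lemma thin_svd_split:
  assumes "thin_svd m n A U \<sigma> V" "k \<le> n"
  shows "split_svd m n k (n - k) A (first_cols k U) (drop_cols k U)
    (mat_diag k (\<lambda>i. \<sigma> (i + 1))) (mat_diag (n - k) (\<lambda>i. \<sigma> (k + 1 + i)))
    (first_cols k V) (drop_cols k V)"
proof -
  have U: "U \<in> carrier_mat m n" "orthonormal_cols U"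
    and V: "V \<in> carrier_mat n n" "orthonormal_cols V"
    and A: "A = U * mat_diag n (\<lambda>i. \<sigma> (i + 1)) * transpose_mat V"
    using assms by (auto simp: thin_svd_def)
  have "k \<le> dim_col U" "k \<le> dim_col V" using U V assms(2) by auto
  then show ?thesis
    using U V mult_diag_split[OF U(1) V(1) assms(2), of "\<lambda>i. \<sigma> (i + 1)"]
      orthonormal_cols_split[OF U(2)] orthonormal_cols_split[OF V(2)]
    unfolding split_svd_def A by (auto simp: add_ac)
qed

text \<open>A nonzero determinant makes \<open>X\<close> a unit of the matrix ring, which rules out
  \<open>None\<close> as the value of \<open>mat_inverse X\<close>.\<close>

lemma mat_inv_right:
  assumes "X \<in> carrier_mat k k" "invertible_mat X"
  shows "mat_inv X \<in> carrier_mat k k" "X * mat_inv X = 1\<^sub>m k"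
proof -
  have "X \<in> Units (ring_mat TYPE(real) k ())"
    using assms by (intro det_non_zero_imp_unit) (simp_all flip: invertible_mat_iff_det)
  then obtain Y where "mat_inverse X = Some Y"
    using mat_inverse(1)[OF assms(1), where b = "()"] by (cases "mat_inverse X") auto
  then show "mat_inv X \<in> carrier_mat k k" "X * mat_inv X = 1\<^sub>m k"
    using mat_inverse(2)[OF assms(1)] by auto
qed

text \<open>The deterministic part, for one fixed sketch \<open>Om\<close>. The powers of \<psi>
  count the multiplications by \<open>A\<close> or its transpose before the columns of
  \<open>Qk\<close> (two) and of \<open>Pk\<close> (three) are formed.\<close>

lemma rand_qlp_bounds:
  assumes "n \<le> m" "k < n" "1 \<le> k" and A: "A \<in> carrier_mat m n"
    and thin: "thin_svd m n A U \<sigma> V" and pos: "0 < \<sigma> k"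
    and Om: "Om \<in> carrier_mat m n"
    and inv: "invertible_mat (sketch_top k U Om)" and qlp: "rand_qlp A Om Q L P"
    and N: "N \<in> {spectral_norm, frobenius_norm}"
  defines "S \<equiv> mat_diag (n - k) (\<lambda>i. \<sigma> (k + 1 + i))"
    and "\<psi> \<equiv> \<sigma> (k + 1) / \<sigma> k" and "Qk \<equiv> first_cols k Q" and "Pk \<equiv> first_cols k P"
    and "c \<equiv> spectral_norm (sketch_bot k U Om * mat_inv (sketch_top k U Om))"
  shows "N ((1\<^sub>m m - Qk * transpose_mat Qk) * A) \<le> N S + N A * \<psi> ^ 2 * c"
    and "N (A * (1\<^sub>m n - Pk * transpose_mat Pk)) \<le> N S + N A * \<psi> ^ 3 * c"
proof -
  have U: "U \<in> carrier_mat m n" and V: "V \<in> carrier_mat n n" using thin by (auto simp: thin_svd_def)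
  define U1 U2 V1 V2 O1 where
    "U1 = first_cols k U" and "U2 = drop_cols k U" and "V1 = first_cols k V" and
    "V2 = drop_cols k V" and "O1 = first_cols k Om"
  define T B where "T = transpose_mat U1 * O1" and "B = transpose_mat U2 * O1"
  define D1 D2 where "D1 = (\<lambda>p. mat_diag k (\<lambda>i. \<sigma> (i + 1) ^ p))"
    and "D2 = (\<lambda>p. mat_diag (n - k) (\<lambda>i. \<sigma> (k + 1 + i) ^ p))"
  have TB: "sketch_top k U Om = T" "sketch_bot k U Om = B"
    using U Om \<open>k < n\<close>
    by (simp_all add: sketch_top_def sketch_bot_def T_def B_def U1_def U2_def O1_def
        first_rows_transpose_mult drop_rows_transpose_mult)
  have dims [simp]: "dim_row U1 = m" "dim_col U1 = k" "dim_row U2 = m" "dim_col U2 = n - k"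
    "dim_row V1 = n" "dim_col V1 = k" "dim_row V2 = n" "dim_col V2 = n - k"
    "dim_row O1 = m" "dim_col O1 = k" "dim_row A = m" "dim_col A = n"
    using U V Om A by (auto simp: U1_def U2_def V1_def V2_def O1_def)
  have T: "T \<in> carrier_mat k k" and B: "B \<in> carrier_mat (n - k) k"
    by (auto simp: T_def B_def intro: carrier_matI)
  note T' = mat_inv_right[OF T inv[unfolded TB]]
  have D: "D1 p \<in> carrier_mat k k" "D2 p \<in> carrier_mat (n - k) (n - k)"
    "D1 1 * D1 p = D1 (Suc p)" "D2 1 * D2 p = D2 (Suc p)" for p
    by (simp_all add: D1_def D2_def)
  have svd: "split_svd m n k (n - k) A U1 U2 (D1 1) (D2 1) V1 V2"
    using thin_svd_split[OF thin, of k] \<open>k < n\<close>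
    by (simp add: U1_def U2_def V1_def V2_def D1_def D2_def)
  then have svdT: "split_svd n m k (n - k) (transpose_mat A) V1 V2 (D1 1) (D2 1) U1 U2"
    by (rule split_svd_transpose) (simp_all add: D1_def D2_def)
  \<comment> \<open>The iterates of \<open>O1\<close> after \<open>p\<close> multiplications,
    alternately by \<open>transpose_mat A\<close> and \<open>A\<close>: \<open>Y\<close> for odd
    \<open>p\<close>, \<open>Z\<close> for even \<open>p\<close>. Those used are \<open>Y 1\<close>,
    \<open>Z 2\<close> and \<open>Y 3\<close>.\<close>
  define Y Z where "Y = (\<lambda>p. V1 * D1 p * T + V2 * D2 p * B)"
    and "Z = (\<lambda>p. U1 * D1 p * T + U2 * D2 p * B)"
  have Y1: "transpose_mat A * O1 = Y 1"
  proof -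
    have "transpose_mat A = V1 * D1 1 * transpose_mat U1 + V2 * D2 1 * transpose_mat U2"
      using svdT by (simp add: split_svd_def)
    then show ?thesis by (simp add: Y_def T_def B_def D1_def D2_def mat_dim)
  qed
  have AY: "A * Y p = Z (Suc p)" for p
    unfolding Y_def Z_def by (simp only: split_svd_mult[OF svd D(1,2) T B] D)
  have AZ: "transpose_mat A * Z p = Y (Suc p)" for p
    unfolding Y_def Z_def by (simp only: split_svd_mult[OF svdT D(1,2) T B] D)
  obtain Qbar Rbar Rhat R where
    qr1: "qr_factorization (transpose_mat A * Om) Qbar Rbar" and
    qr2: "qr_factorization (A * Qbar) Q Rhat" and
    qr3: "qr_factorization (transpose_mat (transpose_mat Q * A)) P R"
    using qlp by (auto simp: rand_qlp_def)
  have dimQ [simp]: "dim_row Qbar = n" "dim_col Qbar = n" "dim_row Q = m" "dim_col Q = n"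
    "dim_row Om = m" "dim_col Om = n"
    using qr1 qr2 Om by (auto simp: qr_factorization_def)
  obtain W1 where W1: "W1 \<in> carrier_mat k k"
    "first_cols k (transpose_mat A * Om) = first_cols k Qbar * W1"
    using qr_factorization_first_cols[OF qr1, of k] \<open>k < n\<close> by auto
  obtain W2 where W2: "W2 \<in> carrier_mat k k" "first_cols k (A * Qbar) = Qk * W2"
    and Qk: "Qk \<in> carrier_mat m k" "orthonormal_cols Qk"
    using qr_factorization_first_cols[OF qr2, of k] \<open>k < n\<close> by (auto simp: Qk_def)
  have QTA: "transpose_mat (transpose_mat Q * A) = transpose_mat A * Q"
    by (simp add: mat_dim)
  obtain W3 where W3: "W3 \<in> carrier_mat k k" "first_cols k (transpose_mat A * Q) = Pk * W3"
    and Pk: "Pk \<in> carrier_mat n k" "orthonormal_cols Pk"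
    using qr_factorization_first_cols[OF qr3[unfolded QTA], of k] \<open>k < n\<close> by (auto simp: Pk_def)
  have dimW [simp]: "dim_row W1 = k" "dim_col W1 = k" "dim_row W2 = k" "dim_col W2 = k"
    "dim_row W3 = k" "dim_col W3 = k" "dim_row Qk = m" "dim_col Qk = k" "dim_row Pk = n" "dim_col Pk = k"
    using W1 W2 W3 Qk Pk by auto
  \<comment> \<open>The three QR steps now place \<open>Y 1\<close>, \<open>Z 2\<close> and
    \<open>Y 3\<close> in the ranges of the leading columns of \<open>Qbar\<close>, \<open>Q\<close>
    and \<open>P\<close>; the triangular blocks accumulate on the right.\<close>
  have Y1': "Y 1 = first_cols k Qbar * W1"
    unfolding Y1[symmetric] O1_def using W1(2) \<open>k < n\<close> by (simp add: first_cols_mult)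
  have "A * first_cols k Qbar = Qk * W2"
    using W2(2) \<open>k < n\<close> by (simp add: first_cols_mult)
  then have "A * (first_cols k Qbar * W1) = Qk * W2 * W1"
    by (intro mult_cancel_left_dim) simp_all
  then have Z2: "Z 2 = Qk * (W2 * W1)"
    using AY[of 1, unfolded Y1'] by (simp add: mat_dim numeral_2_eq_2)
  have "transpose_mat A * Qk = Pk * W3"
    using W3(2) \<open>k < n\<close> by (simp add: first_cols_mult Qk_def)
  then have "transpose_mat A * (Qk * (W2 * W1)) = Pk * W3 * (W2 * W1)"
    by (intro mult_cancel_left_dim) simp_all
  then have Y3: "Y 3 = Pk * (W3 * (W2 * W1))"
    using AZ[of 2, unfolded Z2] by (simp add: mat_dim)
  have \<sigma>: "\<sigma> j \<le> \<sigma> i" "0 \<le> \<sigma> j" if "1 \<le> i" "i \<le> j" "j \<le> n" for i j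
    using thin that by (auto simp: thin_svd_def)
  \<comment> \<open>The bounds \<open>a\<close> and \<open>b\<close> of the residual estimate: the
    smallest leading and the largest trailing singular value, raised to the power \<open>p\<close>.
    Their quotient is the power of \<psi>.\<close>
  have f: "\<sigma> k ^ p \<le> \<sigma> (i + 1) ^ p" if "i < k" for i p
    using that \<sigma>(1)[of "i + 1" k] pos \<open>k < n\<close> by (intro power_mono) auto
  have g: "\<bar>\<sigma> (k + 1 + i) ^ p\<bar> \<le> \<sigma> (k + 1) ^ p" "0 \<le> \<sigma> (k + 1) ^ p" if "i < n - k" for i p
    using that \<sigma>[of "k + 1" "k + 1 + i"] \<sigma>(2)[of "k + 1" "k + 1"]
    by (auto intro: power_mono)
  have S: "S = D2 1" by (simp add: S_def D2_def)
  have "W2 * W1 \<in> carrier_mat k k" by (rule carrier_matI) simp_all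
  \<comment> \<open>The instance at 0 of the sign condition is available because
    \<open>k < n\<close> makes the trailing block nonempty.\<close>
  from residual_norm_le[OF N svd T T' B Qk this Z2[unfolded Z_def D1_def D2_def] f _ g(1) g(2)[of 0]]
  show "N ((1\<^sub>m m - Qk * transpose_mat Qk) * A) \<le> N S + N A * \<psi> ^ 2 * c"
    using pos \<open>k < n\<close> by (simp add: c_def TB S \<psi>_def power_divide)
  have "W3 * (W2 * W1) \<in> carrier_mat k k" by (rule carrier_matI) simp_all
  from residual_norm_le[OF N svdT T T' B Pk this Y3[unfolded Y_def D1_def D2_def] f _ g(1) g(2)[of 0]]
  have "N ((1\<^sub>m n - Pk * transpose_mat Pk) * transpose_mat A) \<le> N S + N A * \<psi> ^ 3 * c"
    using pos \<open>k < n\<close> mat_norm_transpose[OF N, of A] by (simp add: c_def TB S \<psi>_def power_divide)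
  \<comment> \<open>The estimate for \<open>transpose_mat A\<close> is carried back to
    \<open>A\<close>, the projection being symmetric.\<close>
  also have "(1\<^sub>m n - Pk * transpose_mat Pk) * transpose_mat A
      = transpose_mat (A * (1\<^sub>m n - Pk * transpose_mat Pk))"
    by (simp add: mat_dim)
  finally show "N (A * (1\<^sub>m n - Pk * transpose_mat Pk)) \<le> N S + N A * \<psi> ^ 3 * c"
    by (simp only: mat_norm_transpose[OF N])
qed

section \<open>Almost sure invertibility together with the bounds for each outcome\<close>

theorem theorem3:
  fixes M :: "'w measure" and \<Omega> :: "'w \<Rightarrow> real mat"
    and A U V :: "real mat" and \<sigma> :: "nat \<Rightarrow> real" and m n k :: nat
  assumes "m \<ge> n" and "n > k" and "k \<ge> 1"
    and "A \<in> carrier_mat m n"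
    and "thin_svd m n A U \<sigma> V"
    and "\<sigma> k > 0"
    and "std_gaussian_matrix M m n \<Omega>"
  shows "\<P>(\<omega> in M. invertible_mat (sketch_top k U (\<Omega> \<omega>))) = 1 \<and>
    (\<forall>\<omega> \<in> space M. \<forall>Q L P.
       invertible_mat (sketch_top k U (\<Omega> \<omega>)) \<longrightarrow>
       rand_qlp A (\<Omega> \<omega>) Q L P \<longrightarrow>
       (let \<Sigma>perp = mat_diag (n - k) (\<lambda>i. \<sigma> (k + 1 + i));
            \<psi> = \<sigma> (k + 1) / \<sigma> k;
            Qk = first_cols k Q;
            Pk = first_cols k P;
            c = spectral_norm (sketch_bot k U (\<Omega> \<omega>) * mat_inv (sketch_top k U (\<Omega> \<omega>)))
        in \<forall>N \<in> {spectral_norm, frobenius_norm}.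
             N ((1\<^sub>m m - Qk * transpose_mat Qk) * A) \<le> N \<Sigma>perp + N A * \<psi> ^ 2 * c \<and>
             N (A * (1\<^sub>m n - Pk * transpose_mat Pk)) \<le> N \<Sigma>perp + N A * \<psi> ^ 3 * c))"
proof
  interpret prob_space M using assms(7) by (simp add: std_gaussian_matrix_def)
  have Om: "\<Omega> \<omega> \<in> carrier_mat m n" if "\<omega> \<in> space M" for \<omega>
    using assms(7) that by (simp add: std_gaussian_matrix_def)
  have U: "U \<in> carrier_mat m n" "orthonormal_cols U" using assms(5) by (auto simp: thin_svd_def)
  let ?U1 = "first_cols k U"
  let ?d = "\<lambda>\<omega>. det (transpose_mat ?U1 * first_cols k (\<Omega> \<omega>))"
  have U1: "?U1 \<in> carrier_mat m k" "orthonormal_cols ?U1"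
    using U assms(2) by (auto intro!: orthonormal_cols_split carrier_matI)
  \<comment> \<open>The determinant is a measurable function of the outcome, so this description
    shows that invertibility is an event and transfers the almost sure statement to it.\<close>
  have inv: "invertible_mat (sketch_top k U (\<Omega> \<omega>)) \<longleftrightarrow> ?d \<omega> \<noteq> 0" if "\<omega> \<in> space M" for \<omega>
  proof -
    have "sketch_top k U (\<Omega> \<omega>) = transpose_mat ?U1 * first_cols k (\<Omega> \<omega>)"
      using Om[OF that] U(1) assms(2) by (simp add: sketch_top_def first_rows_transpose_mult)
    moreover have "transpose_mat ?U1 * first_cols k (\<Omega> \<omega>) \<in> carrier_mat k k"
      by (rule carrier_matI) simp_all
    ultimately show ?thesis by (simp add: invertible_mat_iff_det)
  qed
  have AE: "AE \<omega> in M. ?d \<omega> \<noteq> 0" and [measurable]: "?d \<in> borel_measurable M"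
    using AE_det_gaussian_nonzero[OF assms(7) _ _ _ U1] assms(1-3) by auto
  have "{\<omega> \<in> space M. invertible_mat (sketch_top k U (\<Omega> \<omega>))} = {\<omega> \<in> space M. ?d \<omega> \<noteq> 0}"
    using inv by auto
  moreover have "{\<omega> \<in> space M. ?d \<omega> \<noteq> 0} \<in> events" by measurable
  ultimately show "\<P>(\<omega> in M. invertible_mat (sketch_top k U (\<Omega> \<omega>))) = 1"
    using AE by (simp add: prob_Collect_eq_1)
  show "\<forall>\<omega> \<in> space M. \<forall>Q L P.
       invertible_mat (sketch_top k U (\<Omega> \<omega>)) \<longrightarrow>
       rand_qlp A (\<Omega> \<omega>) Q L P \<longrightarrow>
       (let \<Sigma>perp = mat_diag (n - k) (\<lambda>i. \<sigma> (k + 1 + i));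
            \<psi> = \<sigma> (k + 1) / \<sigma> k;
            Qk = first_cols k Q;
            Pk = first_cols k P;
            c = spectral_norm (sketch_bot k U (\<Omega> \<omega>) * mat_inv (sketch_top k U (\<Omega> \<omega>)))
        in \<forall>N \<in> {spectral_norm, frobenius_norm}.
             N ((1\<^sub>m m - Qk * transpose_mat Qk) * A) \<le> N \<Sigma>perp + N A * \<psi> ^ 2 * c \<and>
             N (A * (1\<^sub>m n - Pk * transpose_mat Pk)) \<le> N \<Sigma>perp + N A * \<psi> ^ 3 * c)"
    unfolding Let_def
  proof (intro ballI allI impI)
    fix \<omega> Q L P N
    assume \<omega>: "\<omega> \<in> space M" and inv: "invertible_mat (sketch_top k U (\<Omega> \<omega>))"
      and qlp: "rand_qlp A (\<Omega> \<omega>) Q L P" and N: "N \<in> {spectral_norm, frobenius_norm}"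
    let ?S = "mat_diag (n - k) (\<lambda>i. \<sigma> (k + 1 + i))" and ?\<psi> = "\<sigma> (k + 1) / \<sigma> k"
      and ?Qk = "first_cols k Q" and ?Pk = "first_cols k P"
      and ?c = "spectral_norm (sketch_bot k U (\<Omega> \<omega>) * mat_inv (sketch_top k U (\<Omega> \<omega>)))"
    show "N ((1\<^sub>m m - ?Qk * transpose_mat ?Qk) * A) \<le> N ?S + N A * ?\<psi> ^ 2 * ?c \<and>
      N (A * (1\<^sub>m n - ?Pk * transpose_mat ?Pk)) \<le> N ?S + N A * ?\<psi> ^ 3 * ?c"
      by (rule conjI[OF rand_qlp_bounds[OF assms(1-6) Om[OF \<omega>] inv qlp N]])
  qed
qed

end
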